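(* Let $\zeta>0$ be an ordinal and $\xi$ an ordinal. Let $\mathcal{T}$ be a $B$-tree and let $f:C(\mathcal{T})\to\mathbb{R}$ be $\zeta$ small. If $o(\mathcal{T})\geqslant\zeta\xi$, then for any sequence $(\varepsilon_n)\subset(0,1)$ there exists an order preserving $j:\mathcal{T}_\xi\to C(\mathcal{T})$ so that for each $t\in\mathcal{T}_\xi$, $f(j(t))\leqslant\varepsilon_{|t|}$. Moreover, if $f$ is strictly $\zeta$ small, the conclusion holds with $\varepsilon_n=0$ for all $n\in\mathbb{N}$.
   Context: For a set $S$, $S^{<\omega}$ denotes the finite sequences in $S$, including $\varnothing$; $|s|$ is the length of $s$, $s^\frown t$ is concatenation, and $s\prec t$ means $s$ is a proper initial segment of $t$. A tree on $S$ is a subset of $S^{<\omega}$ closed under initial segments; a $B$-tree is a set $T\subset S^{<\omega}\setminus\{\varnothing\}$ with $T\cup\{\varnothing\}$ a tree. With $MAX(T)$ the $\prec$-maximal members of $T$ and $T'=T\setminus MAX(T)$, define $d^0(T)=T$, $d^{\xi+1}(T)=(d^\xi(T))'$, $d^\xi(T)=\bigcap_{\zeta<\xi}d^\zeta(T)$ for limit $\xi$; $o(T)=\min\{\xi:d^\xi(T)=\varnothing\}$, or $\infty$ if no such $\xi$ exists ($\infty$ exceeds every ordinal). A map $f:P\to Q$ between partially ordered sets is order preserving if $x<_Py$ implies $f(x)<_Qf(y)$ (only this implication); trees are ordered by $\prec$. Minimal trees: $\mathcal{MT}_0=\{\varnothing\}$, $\mathcal{MT}_{\xi+1}=\{\varnothing\}\cup\{(\xi+1)^\frown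 t:t\in\mathcal{MT}_\xi\}$, $\mathcal{MT}_\xi=\bigcup_{\zeta<\xi}\mathcal{MT}_{\zeta+1}$ for limit $\xi$, and $\mathcal{T}_\xi=\mathcal{MT}_\xi\setminus\{\varnothing\}$. Segments: for $U\subset S^{<\omega}$, $C(U)$ is the set of finite, non-empty subsets of $U\setminus\{\varnothing\}$ which are linearly ordered by $\prec$; for $c,c'\in C(U)$, $c<c'$ means $s\prec t$ for all $s\in c$, $t\in c'$. An order preserving map $i$ between trees induces a map on segments by $i(c)=\{i(t):t\in c\}$. A function $f:C(\mathcal{T})\to\mathbb{R}$ is $\zeta$ small if for every order preserving $i:\mathcal{T}_\zeta\to\mathcal{T}$, $\inf\{f(i(c)):c\in C(\mathcal{T}_\zeta)\}\leqslant 0$; it is strictly $\zeta$ small if (in addition) this infimum is always a minimum. $\zeta\xi$ is the usual ordinal product, so $\zeta(\xi+1)=\zeta\xi+\zeta$. *)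

theory Defs
  imports Complex_Main "HOL-Library.Extended_Real" "HOL-Library.Sublist" "HOL-Library.Extended"
begin

unbundle cardinal_syntax

text \<open>
  An ordinal is an isomorphism class of well-orders. Since there is no type of all ordinals in HOL,
  the type \<open>'a ordinal\<close> consists of the order types of the well-orders on subsets of
  \<open>'a + nat\<close>, i.e. of all ordinals below the successor cardinal of \<open>max |'a| \<aleph>\<^sub>0\<close>; the summand
  \<open>nat\<close> makes that cardinal infinite. A statement about \<open>'a ordinal\<close> with \<open>'a\<close> a type variable
  is thus a statement about arbitrary ordinals. Lemma \<open>ordinal_bounded\<close> below shows that every set
  of at most \<open>max |'a| \<aleph>\<^sub>0\<close> such ordinals is bounded, so successors, suprema of the segments
  \<open>{..<\<beta>}\<close>, sums and products have their usual values.
\<close>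

lemma ordIso_Well_order: "r =o s \<Longrightarrow> Well_order r \<and> Well_order s"
  by (auto simp: ordIso_def)

lemma ordLess_Well_order: "r <o s \<Longrightarrow> Well_order r \<and> Well_order s"
  by (auto simp: ordLess_def)

lemma ordIso_refl_iff: "r =o r \<longleftrightarrow> Well_order r"
  using ordIso_Well_order ordIso_reflexive by blast

quotient_type 'a ordinal = "('a + nat) rel" / partial: "\<lambda>r s. r =o s"
  morphisms rep_ordinal ord_type
proof (rule part_equivpI)
  show "\<exists>r :: ('a + nat) rel. r =o r"
    using card_of_refl by blast
  show "symp (\<lambda>r s :: ('a + nat) rel. r =o s)"
    by (auto intro: sympI ordIso_symmetric)
  show "transp (\<lambda>r s :: ('a + nat) rel. r =o s)"
    by (auto intro: transpI ordIso_transitive)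
qed

instantiation ordinal :: (type) wellorder
begin

lift_definition less_eq_ordinal :: "'a ordinal \<Rightarrow> 'a ordinal \<Rightarrow> bool"
  is "\<lambda>r s. r \<le>o s"
  by (meson ordIso_ordLeq_trans ordIso_symmetric ordLeq_ordIso_trans)

lift_definition less_ordinal :: "'a ordinal \<Rightarrow> 'a ordinal \<Rightarrow> bool"
  is "\<lambda>r s. r <o s"
  by (meson ordIso_ordLess_trans ordIso_symmetric ordLess_ordIso_trans)

instance
proof
  fix x y z :: "'a ordinal"
  show "x < y \<longleftrightarrow> x \<le> y \<and> \<not> y \<le> x"
    by transfer (metis not_ordLess_ordLeq ordIso_Well_order ordLess_imp_ordLeq ordLess_or_ordLeq)
  show "x \<le> x"
    by transfer (simp add: ordIso_imp_ordLeq)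
  show "x \<le> y \<Longrightarrow> y \<le> z \<Longrightarrow> x \<le> z"
    by transfer (rule ordLeq_transitive)
  show "x \<le> y \<Longrightarrow> y \<le> x \<Longrightarrow> x = y"
    by transfer (simp add: ordIso_iff_ordLeq)
  show "x \<le> y \<or> y \<le> x"
    by transfer (meson ordIso_Well_order ordLeq_total)
next
  fix P :: "'a ordinal \<Rightarrow> bool" and a
  assume step: "\<And>x. (\<And>y. y < x \<Longrightarrow> P y) \<Longrightarrow> P x"
  have lt: "x < y \<longleftrightarrow> rep_ordinal x <o rep_ordinal y" for x y :: "'a ordinal"
    by (simp add: less_ordinal.rep_eq)
  have "wf (inv_image ordLess (rep_ordinal :: 'a ordinal \<Rightarrow> _))"
    by (intro wf_inv_image wf_ordLess)
  then show "P a"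
    by (induction a rule: wf_induct_rule) (auto intro: step simp: lt)
qed

end

lemma Well_order_rep: "Well_order (rep_ordinal \<alpha>)"
  using Quotient3_rep_reflp[OF Quotient3_ordinal] ordIso_refl_iff by blast

lemma ord_type_rep [simp]: "ord_type (rep_ordinal \<alpha>) = \<alpha>"
  by (rule Quotient3_abs_rep[OF Quotient3_ordinal])

lemma ord_type_less: "r <o s \<Longrightarrow> ord_type r < ord_type s"
  by (simp add: less_ordinal.abs_eq ordIso_refl_iff ordLess_Well_order)

lemma ord_type_eq: "r =o s \<Longrightarrow> ord_type r = ord_type s"
  by (rule Quotient3_rel_abs[OF Quotient3_ordinal])

abbreviation (input) init_type :: "('a + nat) rel \<Rightarrow> 'a + nat \<Rightarrow> 'a ordinal" where
  "init_type r x \<equiv> ord_type (Restr r (Order_Relation.underS r x))"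

lemma below_eq_init_types:
  "{..<\<alpha>} = init_type (rep_ordinal \<alpha>) ` Field (rep_ordinal \<alpha>)" (is "_ = ?R")
proof (intro set_eqI iffI)
  fix \<beta> assume "\<beta> \<in> {..<\<alpha>}"
  then have "rep_ordinal \<beta> <o rep_ordinal \<alpha>"
    by (simp add: less_ordinal.rep_eq)
  then obtain a where "a \<in> Field (rep_ordinal \<alpha>)"
      "rep_ordinal \<beta> =o Restr (rep_ordinal \<alpha>) (Order_Relation.underS (rep_ordinal \<alpha>) a)"
    using ordLess_iff_ordIso_Restr[OF Well_order_rep Well_order_rep] by metis
  then show "\<beta> \<in> ?R"
    using ord_type_eq[of "rep_ordinal \<beta>"] by (auto intro!: image_eqI[of _ _ a])
next
  fix \<beta> assume "\<beta> \<in> ?R"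
  then obtain a where a: "a \<in> Field (rep_ordinal \<alpha>)" "\<beta> = init_type (rep_ordinal \<alpha>) a"
    by blast
  have w: "Well_order (Restr (rep_ordinal \<alpha>) (Order_Relation.underS (rep_ordinal \<alpha>) a))"
    by (simp add: Well_order_Restr Well_order_rep)
  then have "Restr (rep_ordinal \<alpha>) (Order_Relation.underS (rep_ordinal \<alpha>) a) <o rep_ordinal \<alpha>"
    using a ordLess_iff_ordIso_Restr[OF Well_order_rep w] ordIso_reflexive[OF w] by blast
  then show "\<beta> \<in> {..<\<alpha>}"
    using a ord_type_less[of _ "rep_ordinal \<alpha>"] by simp
qed

lemma card_below: "|{..<\<alpha> :: 'a ordinal}| \<le>o |UNIV :: ('a + nat) set|"
  unfolding below_eq_init_types by (meson card_of_image card_of_mono1 ordLeq_transitive subset_UNIV)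

lemma init_type_strict_mono:
  assumes r: "Well_order r" and xy: "(x, y) \<in> r" "x \<noteq> y"
  shows "init_type r x < init_type r y"
proof -
  interpret wo_rel r using r by (simp add: wo_rel_def)
  have "Order_Relation.underS r x \<subset> Order_Relation.underS r y"
  proof
    show "Order_Relation.underS r x \<subseteq> Order_Relation.underS r y"
      using xy TRANS ANTISYM by (auto simp: Order_Relation.underS_def dest: transD antisymD)
    show "Order_Relation.underS r x \<noteq> Order_Relation.underS r y"
      using xy by (auto simp: Order_Relation.underS_def)
  qed
  then have "Restr r (Order_Relation.underS r x) <o Restr r (Order_Relation.underS r y)"
    using ofilter_subset_ordLess[OF r underS_ofilter underS_ofilter] by blast
  then show ?thesis by (rule ord_type_less)
qed

lemma card_ordinals: "\<not> |UNIV :: 'a ordinal set| \<le>o |UNIV :: ('a + nat) set|"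
proof
  assume "|UNIV :: 'a ordinal set| \<le>o |UNIV :: ('a + nat) set|"
  then obtain h :: "'a ordinal \<Rightarrow> 'a + nat" where h: "inj h"
    using card_of_ordLeq[of "UNIV :: 'a ordinal set" "UNIV :: ('a + nat) set"] by auto
  define r where "r = {(h x, h y) | x y. x \<le> y}"
  have F: "Field r = range h"
    by (auto simp: r_def Field_def)
  have in_r: "(h x, h y) \<in> r \<longleftrightarrow> x \<le> y" for x y
    using h by (auto simp: r_def inj_def)
  have Lin: "Linear_order r"
    unfolding linear_order_on_def partial_order_on_def preorder_on_def F
  proof (intro conjI)
    show "r \<subseteq> range h \<times> range h" by (auto simp: r_def)
    show "refl_on (range h) r" by (auto simp: refl_on_def r_def)
    show "trans r"
    proof (rule transI)
      fix a b c assume "(a, b) \<in> r" "(b, c) \<in> r"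
      moreover from this obtain x y z where "a = h x" "b = h y" "c = h z"
        by (auto simp: r_def)
      ultimately show "(a, c) \<in> r" by (simp add: in_r)
    qed
    show "antisym r"
    proof (rule antisymI)
      fix a b assume "(a, b) \<in> r" "(b, a) \<in> r"
      moreover from this obtain x y where "a = h x" "b = h y"
        by (auto simp: r_def)
      ultimately show "a = b" by (simp add: in_r)
    qed
    show "total_on (range h) r" by (auto simp: total_on_def in_r)
  qed
  have "r - Id \<subseteq> inv_image {(x, y). x < y} (inv h)"
    using h by (auto simp: r_def inv_image_def order_le_less)
  moreover have "wf (inv_image {(x :: 'a ordinal, y). x < y} (inv h))"
    by (intro wf_inv_image wf)
  ultimately have W: "Well_order r"
    using Lin wf_subset by (simp add: well_order_on_def)
  define k where "k x = init_type r (h x)" for x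
  have k: "k x < k y" if "x < y" for x y
    unfolding k_def
  proof (rule init_type_strict_mono[OF W])
    show "(h x, h y) \<in> r" using that by (simp add: in_r)
    show "h x \<noteq> h y" using that h by (simp add: inj_eq)
  qed
  have ge: "x \<le> k x" for x
  proof (rule ccontr)
    assume "\<not> x \<le> k x"
    then show False
    proof (induction x rule: less_induct)
      case (less x)
      then have "k x < x" by (simp add: not_le)
      then show False using less.IH[of "k x"] k[of "k x" x] by (simp add: not_le)
    qed
  qed
  have "k x < ord_type r" for x
  proof -
    have w: "Well_order (Restr r (Order_Relation.underS r (h x)))"
      by (simp add: Well_order_Restr W)
    then have "Restr r (Order_Relation.underS r (h x)) <o r"
      using ordLess_iff_ordIso_Restr[OF W w] ordIso_reflexive[OF w] F by blast
    then show ?thesis unfolding k_def by (rule ord_type_less)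
  qed
  then show False using ge[of "ord_type r"] by (simp add: not_le[symmetric])
qed

lemma ordinal_bounded:
  fixes A :: "'a ordinal set"
  assumes "|A| \<le>o |UNIV :: ('a + nat) set|"
  shows "\<exists>\<beta>. \<forall>\<alpha>\<in>A. \<alpha> < \<beta>"
proof (rule ccontr)
  assume "\<not> ?thesis"
  then have *: "UNIV = (\<Union>\<alpha>\<in>A. {..<\<alpha>}) \<union> A"
    by (auto simp: not_less order_le_less)
  have inf: "infinite (UNIV :: ('a + nat) set)" by simp
  have "|\<Union>\<alpha>\<in>A. {..<\<alpha>}| \<le>o |UNIV :: ('a + nat) set|"
    using card_of_UNION_ordLeq_infinite[OF inf assms] card_below by blast
  then have "|(\<Union>\<alpha>\<in>A. {..<\<alpha>}) \<union> A| \<le>o |UNIV :: ('a + nat) set|"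
    using card_of_Un_ordLeq_infinite_Field[OF _ _ assms card_of_Card_order] inf
    by (simp add: Field_card_of)
  then show False
    using card_ordinals unfolding *[symmetric] by blast
qed

instantiation ordinal :: (type) zero
begin
lift_definition zero_ordinal :: "'a ordinal" is "{}"
  by (simp add: ordIso_reflexive)
instance ..
end

lemma ordinal_zero_le [simp]: "0 \<le> (\<alpha> :: 'a ordinal)"
proof -
  have e: "|{} :: ('a + nat) set| = {}"
    using Field_card_of[of "{} :: ('a + nat) set"] by (auto simp: Field_def)
  have "({} :: ('a + nat) rel) \<le>o r" if r: "Well_order r" for r :: "('a + nat) rel"
    proof -
    have "|{} :: ('a + nat) set| \<le>o r"
      using ordLeq_transitive[OF card_of_empty card_of_least[OF r]] .
    then show ?thesis unfolding e .
  qed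
  then have "ord_type {} \<le> ord_type (rep_ordinal \<alpha>)"
    using Well_order_rep[of \<alpha>] by (subst less_eq_ordinal.abs_eq) (auto simp: ordIso_refl_iff)
  then show ?thesis by (simp add: zero_ordinal_def)
qed

definition osuc :: "'a ordinal \<Rightarrow> 'a ordinal"
  where "osuc \<alpha> = (LEAST \<beta>. \<alpha> < \<beta>)"

definition is_limit :: "'a ordinal \<Rightarrow> bool"
  where "is_limit \<alpha> \<longleftrightarrow> \<alpha> \<noteq> 0 \<and> (\<forall>\<beta>. \<alpha> \<noteq> osuc \<beta>)"

definition osup :: "'a ordinal set \<Rightarrow> 'a ordinal"
  where "osup A = (LEAST \<beta>. \<forall>\<alpha>\<in>A. \<alpha> \<le> \<beta>)"

lemma less_osuc [simp]: "\<alpha> < osuc \<alpha>"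
proof -
  have "|{\<alpha>}| \<le>o |UNIV :: ('a + nat) set|" by (rule card_of_singl_ordLeq) simp
  then have "\<exists>\<beta>. \<alpha> < \<beta>" using ordinal_bounded by blast
  then show ?thesis unfolding osuc_def by (rule LeastI_ex)
qed

lemma osuc_le_iff: "osuc \<alpha> \<le> \<beta> \<longleftrightarrow> \<alpha> < \<beta>"
  by (metis less_osuc Least_le osuc_def order_less_le_trans)

lemma less_osuc_iff: "\<alpha> < osuc \<beta> \<longleftrightarrow> \<alpha> \<le> \<beta>"
  by (metis osuc_le_iff not_le)

lemma osuc_inject [simp]: "osuc \<alpha> = osuc \<beta> \<longleftrightarrow> \<alpha> = \<beta>"
  by (metis less_osuc_iff order.antisym order.refl)

lemma osuc_nonzero [simp]: "osuc \<alpha> \<noteq> 0" "0 \<noteq> osuc \<alpha>"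
  by (metis less_osuc not_le ordinal_zero_le)+

lemma not_is_limit [simp]: "\<not> is_limit 0" "\<not> is_limit (osuc \<alpha>)"
  by (auto simp: is_limit_def)

lemma osuc_less_limit: "is_limit \<alpha> \<Longrightarrow> \<beta> < \<alpha> \<Longrightarrow> osuc \<beta> < \<alpha>"
  by (metis is_limit_def osuc_le_iff order_le_less)

lemma osup_upper_least:
  fixes A :: "'a ordinal set"
  assumes "|A| \<le>o |UNIV :: ('a + nat) set|"
  shows "\<alpha> \<in> A \<Longrightarrow> \<alpha> \<le> osup A" and "(\<And>\<alpha>. \<alpha> \<in> A \<Longrightarrow> \<alpha> \<le> \<beta>) \<Longrightarrow> osup A \<le> \<beta>"
proof -
  have "\<exists>\<beta>. \<forall>\<alpha>\<in>A. \<alpha> \<le> \<beta>" using ordinal_bounded[OF assms] by (meson less_imp_le)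
  then have "\<forall>\<alpha>\<in>A. \<alpha> \<le> osup A" unfolding osup_def by (rule LeastI_ex)
  then show "\<alpha> \<in> A \<Longrightarrow> \<alpha> \<le> osup A" by blast
  show "(\<And>\<alpha>. \<alpha> \<in> A \<Longrightarrow> \<alpha> \<le> \<beta>) \<Longrightarrow> osup A \<le> \<beta>"
    unfolding osup_def by (rule Least_le) blast
qed

lemma osup_image_below:
  fixes g :: "'a ordinal \<Rightarrow> 'a ordinal"
  shows "\<eta> < \<beta> \<Longrightarrow> g \<eta> \<le> osup (g ` {..<\<beta>})"
    and "(\<And>\<eta>. \<eta> < \<beta> \<Longrightarrow> g \<eta> \<le> \<gamma>) \<Longrightarrow> osup (g ` {..<\<beta>}) \<le> \<gamma>"
proof -
  note * = osup_upper_least[OF ordLeq_transitive[OF card_of_image[of g "{..<\<beta>}"] card_below]]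
  show "\<eta> < \<beta> \<Longrightarrow> g \<eta> \<le> osup (g ` {..<\<beta>})"
    by (rule *(1)) simp
  show "osup (g ` {..<\<beta>}) \<le> \<gamma>" if "\<And>\<eta>. \<eta> < \<beta> \<Longrightarrow> g \<eta> \<le> \<gamma>"
    using that by (intro *(2)) auto
qed

lemma ordinal_cases [case_names zero suc limit]:
  obtains "\<alpha> = 0" | \<beta> where "\<alpha> = osuc \<beta>" | "is_limit \<alpha>"
  unfolding is_limit_def by blast

lemma wf_ordinal: "wf {(\<alpha> :: 'a ordinal, \<beta>). \<alpha> < \<beta>}"
  by (rule wf)

lemma ordinal_induct [case_names zero suc limit]:
  assumes "P 0" "\<And>\<alpha>. P \<alpha> \<Longrightarrow> P (osuc \<alpha>)" "\<And>\<alpha>. is_limit \<alpha> \<Longrightarrow> (\<And>\<beta>. \<beta> < \<alpha> \<Longrightarrow> P \<beta>) \<Longrightarrow> P \<alpha>"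
  shows "P \<alpha>"
proof (induction \<alpha> rule: less_induct)
  case (less \<alpha>)
  then show ?case using assms by (cases \<alpha> rule: ordinal_cases) auto
qed

function ord_add :: "'a ordinal \<Rightarrow> 'a ordinal \<Rightarrow> 'a ordinal" where
  "ord_add \<alpha> 0 = \<alpha>"
| "ord_add \<alpha> (osuc \<beta>) = osuc (ord_add \<alpha> \<beta>)"
| "is_limit \<beta> \<Longrightarrow> ord_add \<alpha> \<beta> = osup ((\<lambda>\<eta>. ord_add \<alpha> \<eta>) ` {..<\<beta>})"
  by (auto elim: ordinal_cases) (metis ordinal_cases)
termination
  by (relation "inv_image {(\<alpha>, \<beta>). \<alpha> < \<beta>} snd") (auto intro: wf_ordinal)

instantiation ordinal :: (type) plus
begin
definition plus_ordinal :: "'a ordinal \<Rightarrow> 'a ordinal \<Rightarrow> 'a ordinal"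
  where "plus_ordinal = ord_add"
instance ..
end

lemma ordinal_add_simps:
  fixes \<alpha> \<beta> :: "'a ordinal"
  shows "\<alpha> + 0 = \<alpha>" and "\<alpha> + osuc \<beta> = osuc (\<alpha> + \<beta>)"
    and "is_limit \<beta> \<Longrightarrow> \<alpha> + \<beta> = osup ((\<lambda>\<eta>. \<alpha> + \<eta>) ` {..<\<beta>})"
  by (simp_all add: plus_ordinal_def)

function ord_mult :: "'a ordinal \<Rightarrow> 'a ordinal \<Rightarrow> 'a ordinal" where
  "ord_mult \<alpha> 0 = 0"
| "ord_mult \<alpha> (osuc \<beta>) = ord_mult \<alpha> \<beta> + \<alpha>"
| "is_limit \<beta> \<Longrightarrow> ord_mult \<alpha> \<beta> = osup ((\<lambda>\<eta>. ord_mult \<alpha> \<eta>) ` {..<\<beta>})"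
  by (auto elim: ordinal_cases) (metis ordinal_cases)
termination
  by (relation "inv_image {(\<alpha>, \<beta>). \<alpha> < \<beta>} snd") (auto intro: wf_ordinal)

instantiation ordinal :: (type) times
begin
definition times_ordinal :: "'a ordinal \<Rightarrow> 'a ordinal \<Rightarrow> 'a ordinal"
  where "times_ordinal = ord_mult"
instance ..
end

lemma ordinal_mult_simps:
  fixes \<alpha> \<beta> :: "'a ordinal"
  shows "\<alpha> * 0 = 0" and "\<alpha> * osuc \<beta> = \<alpha> * \<beta> + \<alpha>"
    and "is_limit \<beta> \<Longrightarrow> \<alpha> * \<beta> = osup ((\<lambda>\<eta>. \<alpha> * \<eta>) ` {..<\<beta>})"
  by (simp_all add: times_ordinal_def)


definition is_tree :: "'s list set \<Rightarrow> bool"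
  where "is_tree T \<longleftrightarrow> (\<forall>t\<in>T. \<forall>s. prefix s t \<longrightarrow> s \<in> T)"

definition B_tree :: "'s list set \<Rightarrow> bool"
  where "B_tree T \<longleftrightarrow> [] \<notin> T \<and> is_tree (insert [] T)"

definition max_nodes :: "'s list set \<Rightarrow> 's list set"
  where "max_nodes T = {t \<in> T. \<not> (\<exists>s\<in>T. strict_prefix t s)}"

function tree_deriv :: "'a ordinal \<Rightarrow> 's list set \<Rightarrow> 's list set" where
  "tree_deriv 0 T = T"
| "tree_deriv (osuc \<xi>) T = tree_deriv \<xi> T - max_nodes (tree_deriv \<xi> T)"
| "is_limit \<xi> \<Longrightarrow> tree_deriv \<xi> T = (\<Inter>\<zeta>\<in>{..<\<xi>}. tree_deriv \<zeta> T)"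
  by (auto elim: ordinal_cases) (metis ordinal_cases)
termination
  by (relation "inv_image {(\<alpha>, \<beta>). \<alpha> < \<beta>} fst") (auto intro: wf_ordinal)

text \<open>
  The type of the order is part of the definition: \<open>('s + 'o) ordinal\<close> contains every ordinal of
  cardinality at most \<open>max |'s| \<aleph>\<^sub>0\<close>, so the derivatives of a tree on \<open>'s\<close> become stationary
  at some member of this type (lemma \<open>tree_deriv_stationary\<close>), and the value is \<open>\<infinity>\<close> exactly if
  no derivative at all is empty. The parameter \<open>'o\<close> leaves room for ordinals of any larger size.
\<close>

definition tree_order :: "'s list set \<Rightarrow> ('s + 'o) ordinal extended" where
  "tree_order T =
     (if \<exists>\<xi> :: ('s + 'o) ordinal. tree_deriv \<xi> T = {}
      then Fin (LEAST \<xi>. tree_deriv \<xi> T = {}) else Pinf)"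

lemma tree_deriv_antimono: "\<zeta> \<le> \<xi> \<Longrightarrow> tree_deriv \<xi> T \<subseteq> tree_deriv \<zeta> T"
proof (induction \<xi> rule: ordinal_induct)
  case zero
  then show ?case by (metis ordinal_zero_le order.antisym order.refl)
next
  case (suc \<xi>)
  then show ?case by (cases "\<zeta> = osuc \<xi>") (auto simp: less_osuc_iff order_le_less)
next
  case (limit \<xi>)
  then show ?case by (cases "\<zeta> = \<xi>") (auto simp: order_le_less)
qed

lemma card_lists:
  assumes "infinite B" "|UNIV :: 's set| \<le>o |B|"
  shows "|UNIV :: 's list set| \<le>o |B|"
proof -
  have len: "|{l :: 's list. length l = n}| \<le>o |B|" for n
  proof (induction n)
    case 0
    have "B \<noteq> {}" using assms(1) by auto
    then show ?case by (simp add: card_of_singl_ordLeq)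
  next
    case (Suc n)
    have "{l :: 's list. length l = Suc n} = (\<lambda>(x, l). x # l) ` (UNIV \<times> {l. length l = n})"
      by (auto simp: length_Suc_conv)
    moreover have "|(UNIV :: 's set) \<times> {l :: 's list. length l = n}| \<le>o |B|"
      by (rule card_of_Sigma_ordLeq_infinite[OF assms]) (simp add: Suc)
    ultimately show ?case
      using ordLeq_transitive[OF card_of_image] by simp
  qed
  have "|UNIV :: nat set| \<le>o |B|"
    using assms(1) infinite_iff_card_of_nat by blast
  then have "|\<Union>n. {l :: 's list. length l = n}| \<le>o |B|"
    by (rule card_of_UNION_ordLeq_infinite[OF assms(1)]) (simp add: len)
  moreover have "(\<Union>n. {l :: 's list. length l = n}) = UNIV" by auto
  ultimately show ?thesis by simp
qed

lemma tree_deriv_stationary: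
  fixes T :: "'s list set"
  shows "\<exists>\<xi> :: ('s + 'o) ordinal. \<forall>\<eta>\<ge>\<xi>. tree_deriv \<eta> T = tree_deriv \<xi> T"
proof (rule ccontr)
  assume *: "\<not> ?thesis"
  have "\<exists>t. t \<in> tree_deriv \<xi> T \<and> t \<notin> tree_deriv (osuc \<xi>) T" for \<xi> :: "('s + 'o) ordinal"
  proof (rule ccontr)
    assume "\<not> ?thesis"
    then have stat: "tree_deriv (osuc \<xi>) T = tree_deriv \<xi> T" by auto
    have "tree_deriv \<eta> T = tree_deriv \<xi> T" if "\<xi> \<le> \<eta>" for \<eta>
      using that
    proof (induction \<eta> rule: ordinal_induct)
      case zero
      then show ?case by (metis ordinal_zero_le order.antisym)
    next
      case (suc \<eta>)
      then show ?case using stat by (cases "\<xi> = osuc \<eta>") (auto simp: less_osuc_iff order_le_less)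
    next
      case (limit \<eta>)
      show ?case
      proof (cases "\<xi> = \<eta>")
        case False
        then have lt: "\<xi> < \<eta>" using limit by simp
        have "tree_deriv \<xi> T \<subseteq> tree_deriv \<zeta> T" if "\<zeta> < \<eta>" for \<zeta>
          using limit.IH[OF that] tree_deriv_antimono[of \<zeta> \<xi> T] by (cases "\<xi> \<le> \<zeta>") auto
        then show ?thesis using lt limit.hyps by auto
      qed simp
    qed
    then show False using * by blast
  qed
  then obtain p where p: "\<And>\<xi> :: ('s + 'o) ordinal. p \<xi> \<in> tree_deriv \<xi> T"
      "\<And>\<xi>. p \<xi> \<notin> tree_deriv (osuc \<xi>) T"
    by metis
  have ne: "p \<xi> \<noteq> p \<eta>" if "\<xi> < \<eta>" for \<xi> \<eta>
    using that p(2)[of \<xi>] p(1)[of \<eta>] tree_deriv_antimono[of "osuc \<xi>" \<eta> T]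
    by (auto simp: osuc_le_iff)
  have "inj p"
  proof (rule injI)
    show "\<xi> = \<eta>" if "p \<xi> = p \<eta>" for \<xi> \<eta>
      using that ne[of \<xi> \<eta>] ne[of \<eta> \<xi>] by (cases \<xi> \<eta> rule: linorder_cases) auto
  qed
  then have "|UNIV :: ('s + 'o) ordinal set| \<le>o |UNIV :: 's list set|"
    using card_of_ordLeq[of "UNIV :: ('s + 'o) ordinal set" "UNIV :: 's list set"] by blast
  also have "|UNIV :: 's list set| \<le>o |UNIV :: (('s + 'o) + nat) set|"
  proof (rule card_lists)
    have "inj (Inl \<circ> Inl :: 's \<Rightarrow> ('s + 'o) + nat)" by (auto simp: inj_def)
    then show "|UNIV :: 's set| \<le>o |UNIV :: (('s + 'o) + nat) set|"
      using card_of_ordLeq[of "UNIV :: 's set" "UNIV :: (('s + 'o) + nat) set"] by blast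
  qed simp
  finally show False using card_ordinals[where 'a = "'s + 'o"] by simp
qed

unbundle no cardinal_syntax

function MT :: "'a ordinal \<Rightarrow> 'a ordinal list set" where
  "MT 0 = {[]}"
| "MT (osuc \<xi>) = {[]} \<union> {[osuc \<xi>] @ t | t. t \<in> MT \<xi>}"
| "is_limit \<xi> \<Longrightarrow> MT \<xi> = (\<Union>\<zeta>\<in>{..<\<xi>}. MT (osuc \<zeta>))"
  by (auto elim: ordinal_cases) (metis ordinal_cases)
termination
  by (relation "{(\<alpha>, \<beta>). \<alpha> < \<beta>}") (auto intro: wf_ordinal osuc_less_limit)

definition min_tree :: "'a ordinal \<Rightarrow> 'a ordinal list set"
  where "min_tree \<xi> = MT \<xi> - {[]}"


definition segments :: "'s list set \<Rightarrow> 's list set set" where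
  "segments U = {c. finite c \<and> c \<noteq> {} \<and> c \<subseteq> U - {[]} \<and> (\<forall>s\<in>c. \<forall>t\<in>c. prefix s t \<or> prefix t s)}"

definition seg_less :: "'s list set \<Rightarrow> 's list set \<Rightarrow> bool"
  where "seg_less c c' \<longleftrightarrow> (\<forall>s\<in>c. \<forall>t\<in>c'. strict_prefix s t)"

definition order_preserving ::
    "'p set \<Rightarrow> ('p \<Rightarrow> 'p \<Rightarrow> bool) \<Rightarrow> 'q set \<Rightarrow> ('q \<Rightarrow> 'q \<Rightarrow> bool) \<Rightarrow> ('p \<Rightarrow> 'q) \<Rightarrow> bool" where
  "order_preserving P lessP Q lessQ h \<longleftrightarrow> h ` P \<subseteq> Q \<and> monotone_on P lessP lessQ h"

text \<open>
  The infimum is taken in the extended reals, where the infimum of a set unbounded below is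
  \<open>-\<infinity>\<close>.
\<close>

definition seg_inf :: "'a ordinal \<Rightarrow> ('s list set \<Rightarrow> real) \<Rightarrow> ('a ordinal list \<Rightarrow> 's list) \<Rightarrow> ereal"
  where "seg_inf \<zeta> f i = (INF c\<in>segments (min_tree \<zeta>). ereal (f (i ` c)))"

definition small :: "'a ordinal \<Rightarrow> 's list set \<Rightarrow> ('s list set \<Rightarrow> real) \<Rightarrow> bool" where
  "small \<zeta> T f \<longleftrightarrow>
     (\<forall>i. order_preserving (min_tree \<zeta>) strict_prefix T strict_prefix i \<longrightarrow> seg_inf \<zeta> f i \<le> 0)"

definition strictly_small :: "'a ordinal \<Rightarrow> 's list set \<Rightarrow> ('s list set \<Rightarrow> real) \<Rightarrow> bool" where
  "strictly_small \<zeta> T f \<longleftrightarrow> small \<zeta> T f \<and>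
     (\<forall>i. order_preserving (min_tree \<zeta>) strict_prefix T strict_prefix i \<longrightarrow>
        (\<exists>c\<in>segments (min_tree \<zeta>). ereal (f (i ` c)) = seg_inf \<zeta> f i))"

end

theory Submission
  imports Defs
begin

text \<open>
  Read \<open>min_tree \<xi>\<close> as a countdown from \<open>\<xi>\<close>: a move takes \<open>\<alpha> + 1\<close> to \<open>\<alpha>\<close>, and at a
  limit ordinal the player first chooses a smaller successor from which to go on. An order
  preserving map out of it is a strategy that answers every move by a larger element of the
  target. Such a strategy exists as soon as every position with \<open>\<alpha> + 1\<close> moves to go has an answer
  leading to a position with \<open>\<alpha>\<close> moves to go, and a position with a limit number of moves to go
  also counts as one for every smaller number: at a limit, the strategies for the different
  choices are put side by side. This is lemma \<open>countdown_strategy\<close>, and it is used twice.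

  A node \<open>s\<close> is said to have rank at least \<open>\<alpha>\<close> if each derivative \<open>d\<^sup>\<beta>(T)\<close> with
  \<open>\<beta> < \<alpha>\<close> contains a proper extension of \<open>s\<close>. For \<open>s \<in> T\<close> this says \<open>s \<in> d\<^sup>\<alpha>(T)\<close>
  (\<open>tree_deriv_iff_rank\<close>), and for the empty sequence it says \<open>o(T) \<ge> \<alpha>\<close>. If \<open>s\<close> has rank at
  least \<open>\<gamma> + \<zeta>\<close>, then playing nodes of \<open>T\<close> against the countdown from \<open>\<zeta>\<close> gives an order
  preserving map of \<open>min_tree \<zeta>\<close> into the part of \<open>d\<^sup>\<gamma>(T)\<close> above \<open>s\<close>
  (\<open>min_tree_into_tree_deriv\<close>).

  In the second use (\<open>segment_strategy\<close>) the answers are segments of \<open>T\<close>, and a segment has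
  \<open>\<alpha>\<close> moves to go if its last node has rank at least \<open>\<zeta>\<alpha>\<close>. With \<open>\<alpha> + 1\<close> moves to go the
  rank is at least \<open>\<zeta>\<alpha> + \<zeta>\<close>, so \<open>min_tree \<zeta>\<close> maps into the derivative of order \<open>\<zeta>\<alpha>\<close>, above
  the last node. Smallness of \<open>f\<close> selects a segment of \<open>min_tree \<zeta>\<close> on whose image \<open>f\<close> is as
  small as desired, and since the last node of the image lies in that derivative, \<open>\<alpha>\<close> moves
  remain.
\<close>

section \<open>Order preserving maps out of minimal trees\<close>

lemma limit_pos: "is_limit \<alpha> \<Longrightarrow> 0 < \<alpha>"
  by (metis not_is_limit(1) order_le_less ordinal_zero_le)

lemma min_tree_0: "min_tree 0 = {}"
  by (simp add: min_tree_def)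

lemma min_tree_osuc: "min_tree (osuc \<xi>) = insert [osuc \<xi>] ((#) (osuc \<xi>) ` min_tree \<xi>)"
proof -
  have "[] \<in> MT \<xi>"
  proof (induction \<xi> rule: ordinal_induct)
    case (limit \<xi>)
    then show ?case using limit_pos[of \<xi>] by auto
  qed auto
  then show ?thesis by (auto simp: min_tree_def)
qed

lemma min_tree_limit: "is_limit \<xi> \<Longrightarrow> min_tree \<xi> = (\<Union>\<zeta><\<xi>. min_tree (osuc \<zeta>))"
  by (auto simp: min_tree_def)

lemma Nil_notin_min_tree: "[] \<notin> min_tree \<xi>"
  by (simp add: min_tree_def)

lemma hd_min_tree_osuc: "t \<in> min_tree (osuc \<xi>) \<Longrightarrow> hd t = osuc \<xi>"
  by (auto simp: min_tree_osuc)

text \<open>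
  \<open>W \<alpha> x\<close> stands for ``from the position \<open>x\<close> one can still answer \<open>\<alpha>\<close> moves'', and
  \<open>P n y\<close> for ``\<open>y\<close> is admissible as the \<open>n\<close>-th answer''. The count \<open>n\<close> of the answers
  already given is a parameter because the induction moves the starting position up the tree.
  Transitivity of \<open>lt\<close> is asked for only through admissible elements, since the order of
  segments is transitive only through non-empty ones.
\<close>

lemma countdown_strategy:
  fixes lt :: "'x \<Rightarrow> 'x \<Rightarrow> bool" and W :: "'a ordinal \<Rightarrow> 'x \<Rightarrow> bool" and P :: "nat \<Rightarrow> 'x \<Rightarrow> bool"
  assumes trans: "\<And>n x y z. lt x y \<Longrightarrow> P n y \<Longrightarrow> lt y z \<Longrightarrow> lt x z"
    and step: "\<And>\<alpha> n x. W (osuc \<alpha>) x \<Longrightarrow> \<exists>y. lt x y \<and> P (Suc n) y \<and> W \<alpha> y"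
    and limit: "\<And>\<alpha> \<beta> x. is_limit \<alpha> \<Longrightarrow> \<beta> < \<alpha> \<Longrightarrow> W \<alpha> x \<Longrightarrow> W \<beta> x"
    and "W \<xi> x"
  shows "\<exists>h. monotone_on (min_tree \<xi>) strict_prefix lt h \<and>
             (\<forall>t\<in>min_tree \<xi>. lt x (h t) \<and> P (n + length t) (h t))"
  using \<open>W \<xi> x\<close>
proof (induction \<xi> arbitrary: x n rule: ordinal_induct)
  case zero
  show ?case by (simp add: min_tree_0 monotone_on_def)
next
  case (suc \<xi>)
  from step[OF suc.prems] obtain y where y: "lt x y" "P (Suc n) y" "W \<xi> y"
    by blast
  from suc.IH[OF y(3), of "Suc n"] obtain h where
    mono: "\<And>t u. t \<in> min_tree \<xi> \<Longrightarrow> u \<in> min_tree \<xi> \<Longrightarrow> strict_prefix t u \<Longrightarrow> lt (h t) (h u)"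
    and h: "\<And>t. t \<in> min_tree \<xi> \<Longrightarrow> lt y (h t) \<and> P (Suc n + length t) (h t)"
    by (auto simp: monotone_on_def)
  define g where "g t = (if tl t = [] then y else h (tl t))" for t
  have "monotone_on (min_tree (osuc \<xi>)) strict_prefix lt g"
    using mono h Nil_notin_min_tree[of \<xi>]
    by (auto simp: monotone_on_def g_def min_tree_osuc)
  moreover have "lt x (g t) \<and> P (n + length t) (g t)" if "t \<in> min_tree (osuc \<xi>)" for t
    using that y h trans Nil_notin_min_tree[of \<xi>] by (force simp: g_def min_tree_osuc)
  ultimately show ?case by blast
next
  case (limit \<xi>)
  define good where "good \<sigma> h \<longleftrightarrow> monotone_on (min_tree \<sigma>) strict_prefix lt h \<and>
      (\<forall>t\<in>min_tree \<sigma>. lt x (h t) \<and> P (n + length t) (h t))" for \<sigma> :: "'a ordinal" and h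
  define H where "H \<sigma> = (SOME h. good \<sigma> h)" for \<sigma>
  have H: "good (osuc \<zeta>) (H (osuc \<zeta>))" if "\<zeta> < \<xi>" for \<zeta>
  proof -
    have less: "osuc \<zeta> < \<xi>" using osuc_less_limit[OF limit.hyps that] .
    have "\<exists>h. good (osuc \<zeta>) h"
      unfolding good_def using limit.IH[OF less assms(3)[OF limit.hyps less limit.prems]] .
    then show ?thesis unfolding H_def by (rule someI_ex)
  qed
  \<comment> \<open>The first entry of a node names the subtree that it lies in, so the maps do not interfere.\<close>
  define g where "g t = H (hd t) t" for t
  have "monotone_on (min_tree \<xi>) strict_prefix lt g"
  proof (rule monotone_onI)
    fix t u assume t: "t \<in> min_tree \<xi>" and u: "u \<in> min_tree \<xi>" and tu: "strict_prefix t u"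
    from t obtain \<zeta> where \<zeta>: "\<zeta> < \<xi>" "t \<in> min_tree (osuc \<zeta>)"
      by (auto simp: min_tree_limit[OF limit.hyps])
    from u obtain \<eta> where \<eta>: "\<eta> < \<xi>" "u \<in> min_tree (osuc \<eta>)"
      by (auto simp: min_tree_limit[OF limit.hyps])
    have "hd t = hd u"
      using tu t Nil_notin_min_tree[of \<xi>] by (cases t; cases u) auto
    with \<zeta>(2) \<eta>(2) have "\<eta> = \<zeta>" by (simp add: hd_min_tree_osuc)
    with H[OF \<zeta>(1)] \<zeta>(2) \<eta>(2) tu show "lt (g t) (g u)"
      by (simp add: good_def g_def hd_min_tree_osuc monotone_on_def)
  qed
  moreover have "lt x (g t) \<and> P (n + length t) (g t)" if t: "t \<in> min_tree \<xi>" for t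
  proof -
    from t obtain \<zeta> where \<zeta>: "\<zeta> < \<xi>" "t \<in> min_tree (osuc \<zeta>)"
      by (auto simp: min_tree_limit[OF limit.hyps])
    with H[OF \<zeta>(1)] show ?thesis by (simp add: good_def g_def hd_min_tree_osuc)
  qed
  ultimately show ?case by blast
qed

section \<open>The rank of a node\<close>

definition rank_ge :: "'s list set \<Rightarrow> 'a ordinal \<Rightarrow> 's list \<Rightarrow> bool"
  where "rank_ge T \<alpha> s \<longleftrightarrow> (\<forall>\<beta><\<alpha>. \<exists>t\<in>tree_deriv \<beta> T. strict_prefix s t)"

lemma rank_ge_antimono: "\<beta> \<le> \<alpha> \<Longrightarrow> rank_ge T \<alpha> s \<Longrightarrow> rank_ge T \<beta> s"
  by (auto simp: rank_ge_def)

lemma tree_deriv_iff_rank: "t \<in> tree_deriv \<alpha> T \<longleftrightarrow> t \<in> T \<and> rank_ge T \<alpha> t"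
proof (induction \<alpha> rule: ordinal_induct)
  case zero
  show ?case by (simp add: rank_ge_def leD)
next
  case (suc \<alpha>)
  have "t \<in> tree_deriv (osuc \<alpha>) T \<longleftrightarrow>
      t \<in> tree_deriv \<alpha> T \<and> (\<exists>s\<in>tree_deriv \<alpha> T. strict_prefix t s)"
    by (auto simp: max_nodes_def)
  also have "\<dots> \<longleftrightarrow> t \<in> T \<and> rank_ge T (osuc \<alpha>) t"
    unfolding suc by (auto simp: rank_ge_def less_osuc_iff order_le_less)
  finally show ?case .
next
  case (limit \<alpha>)
  have "rank_ge T \<alpha> t \<longleftrightarrow> (\<forall>\<beta><\<alpha>. rank_ge T \<beta> t)"
    unfolding rank_ge_def using limit.hyps
    by (meson less_osuc order_less_trans osuc_less_limit)
  then show ?case using limit limit_pos[of \<alpha>] by auto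
qed

lemma rank_ge_Nil:
  fixes \<alpha> :: "('s + 'o) ordinal" and T :: "'s list set"
  assumes "B_tree T" and "tree_order T \<ge> Fin \<alpha>"
  shows "rank_ge T \<alpha> []"
  unfolding rank_ge_def
proof (intro allI impI)
  fix \<beta> assume "\<beta> < \<alpha>"
  have "tree_deriv \<beta> T \<noteq> {}"
  proof
    assume empty: "tree_deriv \<beta> T = {}"
    then have "(LEAST \<xi>. tree_deriv \<xi> T = {}) \<le> \<beta>" by (rule Least_le)
    moreover have "tree_order T = Fin (LEAST \<xi> :: ('s + 'o) ordinal. tree_deriv \<xi> T = {})"
      using empty by (auto simp: tree_order_def)
    ultimately show False using assms(2) \<open>\<beta> < \<alpha>\<close> by auto
  qed
  then obtain t where "t \<in> tree_deriv \<beta> T" by blast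
  moreover from this have "t \<noteq> []"
    using assms(1) by (auto simp: tree_deriv_iff_rank B_tree_def)
  ultimately show "\<exists>t\<in>tree_deriv \<beta> T. strict_prefix [] t"
    by (auto simp: strict_prefix_def)
qed

lemma ordinal_add_le: "\<gamma> \<le> \<gamma> + (\<alpha> :: 'a ordinal)"
proof (induction \<alpha> rule: ordinal_induct)
  case zero
  show ?case by (simp add: ordinal_add_simps)
next
  case (suc \<alpha>)
  then show ?case by (simp add: ordinal_add_simps) (meson less_osuc less_imp_le order_trans)
next
  case (limit \<alpha>)
  then show ?case
    using limit_pos[of \<alpha>] osup_image_below(1)[of 0 \<alpha> "(+) \<gamma>"] by (simp add: ordinal_add_simps)
qed

text \<open>
  Answering by nodes: with \<open>\<alpha>\<close> moves to go the current node has rank at least \<open>\<gamma> + \<alpha>\<close>, so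
  all answers are taken from \<open>d\<^sup>\<gamma>(T)\<close>.
\<close>

lemma min_tree_into_tree_deriv:
  assumes "rank_ge T (\<gamma> + \<zeta>) s"
  shows "\<exists>i. order_preserving (min_tree \<zeta>) strict_prefix
               {t \<in> tree_deriv \<gamma> T. strict_prefix s t} strict_prefix i"
proof -
  have "\<exists>i. monotone_on (min_tree \<zeta>) strict_prefix strict_prefix i \<and>
      (\<forall>t\<in>min_tree \<zeta>. strict_prefix s (i t) \<and> i t \<in> tree_deriv \<gamma> T)"
  proof (rule countdown_strategy[where W = "\<lambda>\<alpha>. rank_ge T (\<gamma> + \<alpha>)"
        and P = "\<lambda>_ t. t \<in> tree_deriv \<gamma> T"])
    show "\<exists>u. strict_prefix t u \<and> u \<in> tree_deriv \<gamma> T \<and> rank_ge T (\<gamma> + \<alpha>) u"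
      if "rank_ge T (\<gamma> + osuc \<alpha>) t" for \<alpha> t
    proof -
      from that obtain u where "u \<in> tree_deriv (\<gamma> + \<alpha>) T" "strict_prefix t u"
        using less_osuc by (auto simp only: rank_ge_def ordinal_add_simps)
      then show ?thesis
        using tree_deriv_antimono[OF ordinal_add_le] tree_deriv_iff_rank by blast
    qed
    show "rank_ge T (\<gamma> + \<beta>) t" if "is_limit \<alpha>" "\<beta> < \<alpha>" "rank_ge T (\<gamma> + \<alpha>) t" for \<alpha> \<beta> t
      using that osup_image_below(1)[of \<beta> \<alpha> "(+) \<gamma>"]
      by (auto simp: ordinal_add_simps intro: rank_ge_antimono)
  qed (use assms in auto)
  then show ?thesis by (auto simp: order_preserving_def)
qed

section \<open>Playing segments\<close>

lemma image_segment:
  assumes "order_preserving U strict_prefix T strict_prefix i" and "[] \<notin> T" and "c \<in> segments U"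
  shows "i ` c \<in> segments T"
proof -
  have "prefix (i s) (i t) \<or> prefix (i t) (i s)" if "s \<in> c" "t \<in> c" for s t
  proof -
    have "s = t \<or> strict_prefix s t \<or> strict_prefix t s" "s \<in> U" "t \<in> U"
      using assms(3) that by (auto simp: segments_def strict_prefix_def)
    then show ?thesis
      using assms(1) by (auto simp: order_preserving_def monotone_on_def strict_prefix_def)
  qed
  then show ?thesis
    using assms by (auto simp: segments_def order_preserving_def) blast+
qed

lemma segment_last:
  assumes "c \<in> segments U"
  obtains s where "s \<in> c" "\<And>t. t \<in> c \<Longrightarrow> prefix t s"
proof -
  have "finite c" "c \<noteq> {}" and chain: "\<And>s t. s \<in> c \<Longrightarrow> t \<in> c \<Longrightarrow> prefix s t \<or> prefix t s"
    using assms by (auto simp: segments_def)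
  then obtain s where s: "s \<in> c" "\<And>t. t \<in> c \<Longrightarrow> length t \<le> length s"
    using obtains_MAX[of c length] Max_ge[of "length ` c"] by (metis finite_imageI imageI)
  have "prefix t s" if "t \<in> c" for t
    using chain[OF that s(1)] s(2)[OF that] by (auto simp: prefix_def)
  with s(1) show thesis using that by blast
qed

text \<open>
  What either notion of smallness provides is the hypothesis \<open>selects\<close>, with any \<open>\<delta> > 0\<close> for
  \<open>small\<close> and with \<open>\<delta> = 0\<close> for \<open>strictly_small\<close>. The two assertions of the theorem are the
  cases \<open>\<delta> = \<epsilon>\<close> and \<open>\<delta> = 0\<close>.
\<close>

lemma segment_strategy:
  fixes \<zeta> \<xi> :: "'a ordinal" and \<delta> :: "nat \<Rightarrow> real"
  assumes "[] \<notin> T"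
    and selects: "\<And>i n. order_preserving (min_tree \<zeta>) strict_prefix T strict_prefix i \<Longrightarrow>
      n \<ge> 1 \<Longrightarrow> \<exists>c\<in>segments (min_tree \<zeta>). f (i ` c) \<le> \<delta> n"
    and "rank_ge T (\<zeta> * \<xi>) []"
  shows "\<exists>j. order_preserving (min_tree \<xi>) strict_prefix (segments T) seg_less j \<and>
             (\<forall>t\<in>min_tree \<xi>. f (j t) \<le> \<delta> (length t))"
proof -
  \<comment> \<open>For a segment, the witness \<open>s\<close> will be its last node.\<close>
  let ?W = "\<lambda>\<alpha> c. \<exists>s. (\<forall>t\<in>c. prefix t s) \<and> rank_ge T (\<zeta> * \<alpha>) s"
  \<comment> \<open>The empty sequence, viewed as a one-point chain, is the position before the first answer.\<close>
  have "\<exists>j. monotone_on (min_tree \<xi>) strict_prefix seg_less j \<and>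
      (\<forall>t\<in>min_tree \<xi>. seg_less {[]} (j t) \<and> (j t \<in> segments T \<and> f (j t) \<le> \<delta> (0 + length t)))"
  proof (rule countdown_strategy[where W = ?W and P = "\<lambda>n c. c \<in> segments T \<and> f c \<le> \<delta> n"])
    show "seg_less a c" if "seg_less a b" "b \<in> segments T \<and> f b \<le> \<delta> n" "seg_less b c" for n a b c
    proof -
      from that(2) obtain t where "t \<in> b" by (auto simp: segments_def)
      with that(1,3) show ?thesis
        unfolding seg_less_def by (meson prefix_order.less_trans)
    qed
  next
    fix \<alpha> n c assume "?W (osuc \<alpha>) c"
    then obtain s where s: "\<And>t. t \<in> c \<Longrightarrow> prefix t s" "rank_ge T (\<zeta> * \<alpha> + \<zeta>) s"
      by (auto simp: ordinal_mult_simps)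
    from min_tree_into_tree_deriv[OF s(2)] obtain i where
      i: "order_preserving (min_tree \<zeta>) strict_prefix
            {t \<in> tree_deriv (\<zeta> * \<alpha>) T. strict_prefix s t} strict_prefix i" by blast
    then have iT: "order_preserving (min_tree \<zeta>) strict_prefix T strict_prefix i"
      by (auto simp: order_preserving_def tree_deriv_iff_rank)
    from selects[OF this, of "Suc n"] obtain d where
      d: "d \<in> segments (min_tree \<zeta>)" "f (i ` d) \<le> \<delta> (Suc n)" by auto
    have seg: "i ` d \<in> segments T"
      using image_segment[OF iT \<open>[] \<notin> T\<close> d(1)] .
    have above: "t \<in> tree_deriv (\<zeta> * \<alpha>) T" "strict_prefix s t" if "t \<in> i ` d" for t
      using that i d(1) by (auto simp: order_preserving_def segments_def)
    obtain u where u: "u \<in> i ` d" "\<And>t. t \<in> i ` d \<Longrightarrow> prefix t u"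
      using segment_last[OF seg] by blast
    have "seg_less c (i ` d)"
      unfolding seg_less_def using s(1) above(2) by (meson prefix_order.le_less_trans)
    moreover have "?W \<alpha> (i ` d)"
      using u above(1)[OF u(1)] tree_deriv_iff_rank by blast
    ultimately show "\<exists>y. seg_less c y \<and> (y \<in> segments T \<and> f y \<le> \<delta> (Suc n)) \<and> ?W \<alpha> y"
      using seg d(2) by blast
  next
    show "?W \<beta> c" if "is_limit \<alpha>" "\<beta> < \<alpha>" "?W \<alpha> c" for \<alpha> \<beta> c
    proof -
      have "\<zeta> * \<beta> \<le> \<zeta> * \<alpha>"
        using that osup_image_below(1)[of \<beta> \<alpha> "(*) \<zeta>"] by (simp add: ordinal_mult_simps)
      with that(3) show ?thesis by (blast intro: rank_ge_antimono)
    qed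
  next
    show "?W \<xi> {[]}" using assms(3) by auto
  qed
  then show ?thesis by (auto simp: order_preserving_def)
qed

theorem lemma3p1:
  fixes \<zeta> \<xi> :: "('s + 'o) ordinal"
    and T :: "'s list set"
    and f :: "'s list set \<Rightarrow> real"
  assumes "\<zeta> > 0"
    and "B_tree T"
    and "small \<zeta> T f"
    and "tree_order T \<ge> Fin (\<zeta> * \<xi>)"
  shows "(\<forall>\<epsilon> :: nat \<Rightarrow> real. (\<forall>n\<ge>1. \<epsilon> n \<in> {0<..<1}) \<longrightarrow>
            (\<exists>j. order_preserving (min_tree \<xi>) strict_prefix (segments T) seg_less j \<and>
                 (\<forall>t\<in>min_tree \<xi>. f (j t) \<le> \<epsilon> (length t))))
       \<and> (strictly_small \<zeta> T f \<longrightarrow>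
            (\<exists>j. order_preserving (min_tree \<xi>) strict_prefix (segments T) seg_less j \<and>
                 (\<forall>t\<in>min_tree \<xi>. f (j t) \<le> 0)))"
proof (intro conjI allI impI)
  have T: "[] \<notin> T" using assms(2) by (simp add: B_tree_def)
  note rank = rank_ge_Nil[OF assms(2,4)]
  show "\<exists>j. order_preserving (min_tree \<xi>) strict_prefix (segments T) seg_less j \<and>
      (\<forall>t\<in>min_tree \<xi>. f (j t) \<le> \<epsilon> (length t))"
    if \<epsilon>: "\<forall>n\<ge>1. \<epsilon> n \<in> {0<..<1}" for \<epsilon> :: "nat \<Rightarrow> real"
  proof (rule segment_strategy[OF T _ rank])
    fix i n assume i: "order_preserving (min_tree \<zeta>) strict_prefix T strict_prefix i" and "n \<ge> (1::nat)"
    have "seg_inf \<zeta> f i \<le> 0" using assms(3) i by (simp add: small_def)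
    also have "0 < ereal (\<epsilon> n)" using \<epsilon> \<open>n \<ge> 1\<close> by simp
    finally show "\<exists>c\<in>segments (min_tree \<zeta>). f (i ` c) \<le> \<epsilon> n"
      unfolding seg_inf_def by (auto simp: INF_less_iff intro: less_imp_le)
  qed
  show "\<exists>j. order_preserving (min_tree \<xi>) strict_prefix (segments T) seg_less j \<and>
      (\<forall>t\<in>min_tree \<xi>. f (j t) \<le> 0)" if strict: "strictly_small \<zeta> T f"
  proof (rule segment_strategy[OF T _ rank, where \<delta> = "\<lambda>_. 0"])
    fix i assume i: "order_preserving (min_tree \<zeta>) strict_prefix T strict_prefix i"
    with strict obtain c where c: "c \<in> segments (min_tree \<zeta>)" "ereal (f (i ` c)) = seg_inf \<zeta> f i"
      by (auto simp: strictly_small_def)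
    moreover have "seg_inf \<zeta> f i \<le> 0" using assms(3) i by (simp add: small_def)
    ultimately show "\<exists>c\<in>segments (min_tree \<zeta>). f (i ` c) \<le> 0"
      by (metis ereal_less_eq(3) zero_ereal_def)
  qed
qed

end
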